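(* Let $\mathscr{S} \ni s \mapsto T_s \in \mathscr{L}(H)$ be a homomorphism of a weakly right amenable SGT $\mathscr{S}$ into $\mathscr{L}(H)$ (where $H$ is a Hilbert space) that is continuous in the strong operator topology of $\mathscr{L}(H)$. There exists an invertible positive operator $A \in \mathscr{L}(H)$ such that $A T_s A^{-1}$ is an isometry for each $s \in \mathscr{S}$ if and only if there are two positive real constants $m$ and $M$ such that $$m \|x\| \leqslant \|T_s x\| \leqslant M \|x\| \qquad (s \in \mathscr{S},\ x \in H).$$ Moreover, if this last condition holds (with constants $m$, $M$), an invertible positive operator $A \in \mathscr{L}(H)$ such that $A T_s A^{-1}$ is an isometry for each $s \in \mathscr{S}$ can be chosen so that $m I \leqslant A \leqslant M I$.
   Context: An SGT (semigroup with topology) is a non-empty semigroup $\mathscr{S}$ that is also a (possibly non-Hausdorff) topological space; no compatibility between the multiplication and the topology is assumed. For $f:\mathscr{S}\to\mathbb{R}$ and $s\in\mathscr{S}$ let $f_s(t)=f(ts)$. $C_b(\mathscr{S})$ is the space of bounded continuous real-valued functions on $\mathscr{S}$ with the sup-norm, and $C_r(\mathscr{S})=\{f\in C_b(\mathscr{S}): f_s \text{ is continuous for every } s\in\mathscr{S}\}$. Let $C_{norm}(\mathscr{S})$ be the set of all $f\in C_r(\mathscr{S})$ such that $s\mapsto f_s$ and, for all $t\in\mathscr{S}$, $s\mapsto f_{st}$ are continuous from $\mathscr{S}$ to $C_r(\mathscr{S})$ with the norm topology. $\mathscr{S}$ is weakly right amenable if there is a right invariant mean on $C_{norm}(\mathscr{S})$,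 i.e. a linear functional $\phi:C_{norm}(\mathscr{S})\to\mathbb{R}$ with $\inf f(\mathscr{S})\leqslant\phi(f)\leqslant\sup f(\mathscr{S})$ and $\phi(f_s)=\phi(f)$ for all $f\in C_{norm}(\mathscr{S})$, $s\in\mathscr{S}$. Hilbert spaces are real or complex. $\mathscr{L}(H)$ is the algebra of bounded linear operators on $H$ and $I$ is the identity operator; $s\mapsto T_s$ is a homomorphism if $T_{st}=T_sT_t$ for all $s,t$. The order $\leqslant$ is the usual order on self-adjoint operators. An isometry need not be surjective. *)

theory Defs
  imports "HOL-Analysis.Analysis"
begin

section \<open>Semigroups with topology and weak right amenability\<close>

text \<open>
  A semigroup with topology is a type of sort \<open>{semigroup_mult, topological_space}\<close>:
  neither class relates multiplication and topology, no separation axiom is assumed, and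
  non-emptiness is automatic.
  The space of bounded continuous real-valued functions is the library type
  \<open>'s \<Rightarrow>\<^sub>C real\<close> with its supremum norm.
\<close>

definition C_r :: "('s::{semigroup_mult,topological_space} \<Rightarrow>\<^sub>C real) set" where
  "C_r = {f. \<forall>s. continuous_on UNIV (\<lambda>t. apply_bcontfun f (t * s))}"

text \<open>The translate \<open>f\<^sub>s\<close>. Since \<^const>\<open>Bcontfun\<close> is unspecified outside the bounded continuous
  functions, this is meaningful only for \<open>f \<in> C_r\<close>.\<close>

definition rtranslate ::
  "('s::{semigroup_mult,topological_space} \<Rightarrow>\<^sub>C real) \<Rightarrow> 's \<Rightarrow> ('s \<Rightarrow>\<^sub>C real)" where
  "rtranslate f s = Bcontfun (\<lambda>t. apply_bcontfun f (t * s))"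

definition C_norm :: "('s::{semigroup_mult,topological_space} \<Rightarrow>\<^sub>C real) set" where
  "C_norm = {f \<in> C_r. continuous_on UNIV (\<lambda>s. rtranslate f s) \<and>
                      (\<forall>t. continuous_on UNIV (\<lambda>s. rtranslate f (s * t)))}"

lemma apply_rtranslate:
  assumes "f \<in> C_r"
  shows "apply_bcontfun (rtranslate f s) t = apply_bcontfun f (t * s)"
proof -
  have "bounded (range (\<lambda>t. apply_bcontfun f (t * s)))"
    by (rule bounded_subset[OF bounded_apply_bcontfun[of f]]) auto
  then have "(\<lambda>t. apply_bcontfun f (t * s)) \<in> bcontfun"
    using assms by (auto simp: C_r_def bcontfun_def)
  then show ?thesis
    by (simp add: rtranslate_def Bcontfun_inverse)
qed

lemma rtranslate_in_C_r: "f \<in> C_r \<Longrightarrow> rtranslate f s \<in> C_r"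
  using apply_rtranslate[of f s] by (simp add: C_r_def mult.assoc)

lemma rtranslate_rtranslate:
  "f \<in> C_r \<Longrightarrow> rtranslate (rtranslate f s) t = rtranslate f (t * s)"
  by (rule bcontfun_eqI) (simp add: apply_rtranslate rtranslate_in_C_r mult.assoc)

lemma rtranslate_in_C_norm: "f \<in> C_norm \<Longrightarrow> rtranslate f s \<in> C_norm"
  by (auto simp: C_norm_def rtranslate_in_C_r rtranslate_rtranslate mult.assoc)

lemma subspace_C_r: "subspace C_r"
  by (auto simp: subspace_def C_r_def intro!: continuous_intros)

lemma rtranslate_add:
  "f \<in> C_r \<Longrightarrow> g \<in> C_r \<Longrightarrow> rtranslate (f + g) s = rtranslate f s + rtranslate g s"
  by (rule bcontfun_eqI) (simp add: apply_rtranslate subspace_add[OF subspace_C_r])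

lemma rtranslate_scaleR: "f \<in> C_r \<Longrightarrow> rtranslate (c *\<^sub>R f) s = c *\<^sub>R rtranslate f s"
  by (rule bcontfun_eqI) (simp add: apply_rtranslate subspace_scale[OF subspace_C_r])

lemma subspace_C_norm: "subspace (C_norm :: ('s::{semigroup_mult,topological_space} \<Rightarrow>\<^sub>C real) set)"
proof -
  have "rtranslate 0 s = 0" for s :: 's
    using rtranslate_scaleR[OF subspace_0[OF subspace_C_r], of 0 s] by simp
  then show ?thesis
    using subspace_C_r
    by (auto simp: subspace_def C_norm_def rtranslate_add rtranslate_scaleR
        intro!: continuous_intros)
qed

text \<open>The functional lives on the subspace \<^const>\<open>C_norm\<close>; its values elsewhere are irrelevant.\<close>

definition right_invariant_mean ::
  "(('s::{semigroup_mult,topological_space} \<Rightarrow>\<^sub>C real) \<Rightarrow> real) \<Rightarrow> bool" where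
  "right_invariant_mean \<phi> \<longleftrightarrow>
     (\<forall>f\<in>C_norm. \<forall>g\<in>C_norm. \<phi> (f + g) = \<phi> f + \<phi> g) \<and>
     (\<forall>c. \<forall>f\<in>C_norm. \<phi> (c *\<^sub>R f) = c * \<phi> f) \<and>
     (\<forall>f\<in>C_norm. (INF t. apply_bcontfun f t) \<le> \<phi> f \<and> \<phi> f \<le> (SUP t. apply_bcontfun f t)) \<and>
     (\<forall>f\<in>C_norm. \<forall>s. \<phi> (rtranslate f s) = \<phi> f)"

definition weakly_right_amenable ::
  "'s::{semigroup_mult,topological_space} itself \<Rightarrow> bool" where
  "weakly_right_amenable _ \<longleftrightarrow>
     (\<exists>\<phi> :: ('s \<Rightarrow>\<^sub>C real) \<Rightarrow> real. right_invariant_mean \<phi>)"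


section \<open>Complex inner product spaces\<close>

text \<open>
  A complex inner product space, linear in the first argument, is also a real inner product space
  under the real part of its inner product. Building the class on \<^class>\<open>real_inner\<close> makes the
  norm the usual one (see \<open>norm_eq_sqrt_cinner\<close>) and gives access to the library's bounded
  operators. A complex Hilbert space is a type of sort \<open>{complex_inner, complete_space}\<close>.
\<close>

class complex_inner = real_inner +
  fixes scaleC :: "complex \<Rightarrow> 'a \<Rightarrow> 'a"  (infixr \<open>*\<^sub>C\<close> 75)
    and cinner :: "'a \<Rightarrow> 'a \<Rightarrow> complex"
  assumes scaleC_add_right: "a *\<^sub>C (x + y) = a *\<^sub>C x + a *\<^sub>C y"
    and scaleC_add_left: "(a + b) *\<^sub>C x = a *\<^sub>C x + b *\<^sub>C x"
    and scaleC_scaleC: "a *\<^sub>C b *\<^sub>C x = (a * b) *\<^sub>C x"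
    and scaleC_of_real: "complex_of_real r *\<^sub>C x = r *\<^sub>R x"
    and cinner_commute: "cinner x y = cnj (cinner y x)"
    and cinner_add_left: "cinner (x + y) z = cinner x z + cinner y z"
    and cinner_scaleC_left: "cinner (a *\<^sub>C x) y = a * cinner x y"
    and inner_eq_Re_cinner: "inner x y = Re (cinner x y)"

lemma cinner_self: "cinner x x = complex_of_real ((norm x)\<^sup>2)"
  for x :: "'a::complex_inner"
proof (rule complex_eqI)
  show "Im (cinner x x) = Im (complex_of_real ((norm x)\<^sup>2))"
    using arg_cong[OF cinner_commute[of x x], of Im] by simp
  show "Re (cinner x x) = Re (complex_of_real ((norm x)\<^sup>2))"
    by (simp add: power2_norm_eq_inner inner_eq_Re_cinner)
qed

lemma norm_eq_sqrt_cinner: "norm x = sqrt (Re (cinner x x))"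
  for x :: "'a::complex_inner"
  by (simp add: cinner_self)

instantiation complex :: complex_inner
begin

definition scaleC_complex :: "complex \<Rightarrow> complex \<Rightarrow> complex" where
  "scaleC_complex a x = a * x"

definition cinner_complex :: "complex \<Rightarrow> complex \<Rightarrow> complex" where
  "cinner_complex x y = x * cnj y"

instance
  by standard (auto simp: scaleC_complex_def cinner_complex_def inner_complex_def
      algebra_simps scaleR_conv_of_real)

end


section \<open>Bounded operators\<close>

definition invertible_op :: "('h::real_normed_vector \<Rightarrow>\<^sub>L 'h) \<Rightarrow> bool" where
  "invertible_op A \<longleftrightarrow> (\<exists>B. A o\<^sub>L B = id_blinfun \<and> B o\<^sub>L A = id_blinfun)"

definition inverse_op :: "('h::real_normed_vector \<Rightarrow>\<^sub>L 'h) \<Rightarrow> ('h \<Rightarrow>\<^sub>L 'h)" where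
  "inverse_op A = (THE B. A o\<^sub>L B = id_blinfun \<and> B o\<^sub>L A = id_blinfun)"

lemma inverse_op:
  assumes "invertible_op A"
  shows "A o\<^sub>L inverse_op A = id_blinfun" and "inverse_op A o\<^sub>L A = id_blinfun"
proof -
  have "\<exists>!B. A o\<^sub>L B = id_blinfun \<and> B o\<^sub>L A = id_blinfun"
  proof (rule ex_ex1I)
    show "\<exists>B. A o\<^sub>L B = id_blinfun \<and> B o\<^sub>L A = id_blinfun"
      using assms by (simp add: invertible_op_def)
  next
    fix B C
    assume B: "A o\<^sub>L B = id_blinfun \<and> B o\<^sub>L A = id_blinfun"
      and C: "A o\<^sub>L C = id_blinfun \<and> C o\<^sub>L A = id_blinfun"
    have "B = (C o\<^sub>L A) o\<^sub>L B"
      using C by (auto intro: blinfun_eqI)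
    also have "\<dots> = C o\<^sub>L (A o\<^sub>L B)"
      by (auto intro: blinfun_eqI)
    also have "\<dots> = C"
      using B by (auto intro: blinfun_eqI)
    finally show "B = C" .
  qed
  from theI'[OF this]
  show "A o\<^sub>L inverse_op A = id_blinfun" and "inverse_op A o\<^sub>L A = id_blinfun"
    by (simp_all add: inverse_op_def)
qed

definition isometry_op :: "('h::real_normed_vector \<Rightarrow>\<^sub>L 'h) \<Rightarrow> bool" where
  "isometry_op V \<longleftrightarrow> (\<forall>x y. dist (V x) (V y) = dist x y)"

subsection \<open>Real scalars\<close>

definition selfadjoint_op :: "('h::real_inner \<Rightarrow>\<^sub>L 'h) \<Rightarrow> bool" where
  "selfadjoint_op A \<longleftrightarrow> (\<forall>x y. inner (A x) y = inner x (A y))"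

definition op_le :: "('h::real_inner \<Rightarrow>\<^sub>L 'h) \<Rightarrow> ('h \<Rightarrow>\<^sub>L 'h) \<Rightarrow> bool"  (infix \<open>\<le>\<^sub>o\<^sub>p\<close> 50) where
  "A \<le>\<^sub>o\<^sub>p B \<longleftrightarrow> selfadjoint_op A \<and> selfadjoint_op B \<and> (\<forall>x. inner (A x) x \<le> inner (B x) x)"

definition positive_op :: "('h::real_inner \<Rightarrow>\<^sub>L 'h) \<Rightarrow> bool" where
  "positive_op A \<longleftrightarrow> 0 \<le>\<^sub>o\<^sub>p A"

subsection \<open>Complex scalars\<close>

text \<open>The elements of \<open>'h \<Rightarrow>\<^sub>L 'h\<close> are the bounded real-linear maps; the bounded complex-linear
  ones form the set \<open>clinear_ops\<close>. It is closed under inverses, so \<^const>\<open>invertible_op\<close> is also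
  invertibility among complex-linear operators.\<close>

definition clinear_ops :: "('h::complex_inner \<Rightarrow>\<^sub>L 'h) set" where
  "clinear_ops = {A. \<forall>c x. blinfun_apply A (c *\<^sub>C x) = c *\<^sub>C blinfun_apply A x}"

lemma inverse_op_in_clinear_ops:
  assumes "A \<in> clinear_ops" and "invertible_op A"
  shows "inverse_op A \<in> clinear_ops"
proof -
  have AB: "A (inverse_op A x) = x" and BA: "inverse_op A (A x) = x" for x
    using inverse_op[OF assms(2)] by (metis blinfun_apply_blinfun_compose blinfun_apply_id_blinfun)+
  have "inverse_op A (c *\<^sub>C x) = c *\<^sub>C inverse_op A x" for c x
  proof -
    have "c *\<^sub>C x = A (c *\<^sub>C inverse_op A x)"
      using assms(1) by (simp add: clinear_ops_def AB)
    then show ?thesis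
      by (simp add: BA)
  qed
  then show ?thesis
    by (simp add: clinear_ops_def)
qed

definition cselfadjoint_op :: "('h::complex_inner \<Rightarrow>\<^sub>L 'h) \<Rightarrow> bool" where
  "cselfadjoint_op A \<longleftrightarrow> A \<in> clinear_ops \<and> (\<forall>x y. cinner (A x) y = cinner x (A y))"

text \<open>For a self-adjoint operator the values \<open>cinner (A x) x\<close> are real, so comparing
  real parts loses nothing.\<close>

definition cop_le :: "('h::complex_inner \<Rightarrow>\<^sub>L 'h) \<Rightarrow> ('h \<Rightarrow>\<^sub>L 'h) \<Rightarrow> bool"  (infix \<open>\<le>\<^sub>c\<^sub>o\<^sub>p\<close> 50) where
  "A \<le>\<^sub>c\<^sub>o\<^sub>p B \<longleftrightarrow> cselfadjoint_op A \<and> cselfadjoint_op B \<and>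
     (\<forall>x. Re (cinner (A x) x) \<le> Re (cinner (B x) x))"

definition cpositive_op :: "('h::complex_inner \<Rightarrow>\<^sub>L 'h) \<Rightarrow> bool" where
  "cpositive_op A \<longleftrightarrow> 0 \<le>\<^sub>c\<^sub>o\<^sub>p A"

end

theory Submission
  imports Defs
begin

text \<open>
  If \<open>A T\<^sub>s A\<^sup>-\<^sup>1\<close> is isometric for all \<open>s\<close>, then \<open>\<parallel>A T\<^sub>s x\<parallel> = \<parallel>A x\<parallel>\<close>, and
  the two-sided bound follows because \<open>A\<close> distorts norms by bounded factors
  (\<open>bounds_of_similar_to_isometries\<close>).

  Conversely, suppose \<open>m \<parallel>x\<parallel> \<le> \<parallel>T\<^sub>s x\<parallel> \<le> M \<parallel>x\<parallel>\<close>. The function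
  \<open>f\<^sub>x\<^sub>,\<^sub>y(s) = \<langle>T\<^sub>s x, T\<^sub>s y\<rangle>\<close> lies in \<^const>\<open>C_norm\<close>, and its translate by \<open>s\<close> is the
  function of the same kind belonging to \<open>T\<^sub>s x\<close> and \<open>T\<^sub>s y\<close>. Averaging with a right invariant
  mean \<open>\<phi>\<close> gives a symmetric form \<open>B(x, y) = \<phi>(f\<^sub>x\<^sub>,\<^sub>y)\<close> that every \<open>T\<^sub>s\<close> preserves and that satisfies
  \<open>m\<^sup>2 \<parallel>x\<parallel>\<^sup>2 \<le> B(x, x) \<le> M\<^sup>2 \<parallel>x\<parallel>\<^sup>2\<close> (\<open>invariant_form\<close>). By the Riesz representation theorem
  \<open>B(x, y) = \<langle>P x, y\<rangle>\<close> for a self-adjoint operator \<open>P\<close>. Its positive square root \<open>A\<close> satisfies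
  \<open>m I \<le> A \<le> M I\<close> and \<open>\<parallel>A x\<parallel>\<^sup>2 = B(x, x)\<close>, so \<open>\<parallel>A T\<^sub>s x\<parallel> = \<parallel>A x\<parallel>\<close>, which says that
  \<open>A T\<^sub>s A\<^sup>-\<^sup>1\<close> is isometric.

  The square root is \<open>A = M (I - Y)\<close>, where \<open>Y\<close> is the fixed point of \<open>Y \<mapsto> (X + Y\<^sup>2) / 2\<close> for
  \<open>X = I - P / M\<^sup>2\<close>. On the self-adjoint \<open>Y \<ge> 0\<close> with \<open>\<parallel>Y\<parallel> \<le> 1 - m / M\<close> this map is a
  contraction, and these constraints on \<open>Y\<close> are exactly what yields \<open>m I \<le> A \<le> M I\<close>
  (\<open>contractive_root_of_one_minus\<close>, \<open>positive_square_root\<close>).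

  A complex Hilbert space is treated as a real one on which multiplication by \<open>\<i>\<close> is a surjective
  isometry commuting with every \<open>T\<^sub>s\<close>. Such an isometry preserves \<open>B\<close>, hence commutes with \<open>P\<close>, hence
  with \<open>A\<close>, because the fixed point can be sought among the operators commuting with everything
  that commutes with \<open>P\<close>. So \<open>A\<close> is complex-linear.
\<close>

section \<open>Completeness of the space of bounded operators\<close>

text \<open>
  The codomain has sort \<open>{real_normed_vector, complete_space}\<close> because this covers the sort
  \<open>{real_inner, complete_space}\<close> of Hilbert spaces, whereas a type of the latter sort need not be
  declared an instance of \<^class>\<open>banach\<close>. The limit is the pointwise one.
\<close>
lemma complete_UNIV_blinfun:
  "complete (UNIV :: ('a::real_normed_vector \<Rightarrow>\<^sub>L 'b::{real_normed_vector,complete_space}) set)"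
  unfolding complete_def
proof (intro allI impI)
  fix X :: "nat \<Rightarrow> 'a \<Rightarrow>\<^sub>L 'b"
  assume "(\<forall>n. X n \<in> UNIV) \<and> Cauchy X"
  then have X: "Cauchy X" by simp
  define L where "L x = lim (\<lambda>n. X n x)" for x
  have L: "(\<lambda>n. X n x) \<longlonglongrightarrow> L x" for x
    unfolding L_def
    using bounded_linear.Cauchy[OF blinfun.bounded_linear_left X]
    by (simp add: Cauchy_convergent convergent_LIMSEQ_iff[symmetric])
  obtain K where K: "norm (X n) \<le> K" for n
    using Cauchy_Bseq[OF X] by (auto simp: Bseq_def)
  have "bounded_linear L"
  proof (rule bounded_linear_intro[where K = K])
    show "L (x + y) = L x + L y" for x y
      using tendsto_add[OF L[of x] L[of y]] L[of "x + y"]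
      by (auto simp: blinfun.add_right intro: LIMSEQ_unique)
    show "L (c *\<^sub>R x) = c *\<^sub>R L x" for c x
      using tendsto_scaleR[OF tendsto_const L[of x]] L[of "c *\<^sub>R x"]
      by (auto simp: blinfun.scaleR_right intro: LIMSEQ_unique)
    show "norm (L x) \<le> norm x * K" for x
    proof (rule LIMSEQ_le_const2[OF tendsto_norm[OF L]], intro exI allI impI)
      show "norm (X n x) \<le> norm x * K" for n
        using norm_blinfun[of "X n" x] mult_right_mono[OF K[of n] norm_ge_zero[of x]]
        by (simp add: mult.commute)
    qed
  qed
  then have BL: "blinfun_apply (Blinfun L) x = L x" for x
    by (simp add: bounded_linear_Blinfun_apply)
  have "X \<longlonglongrightarrow> Blinfun L"
  proof (rule LIMSEQ_I)
    fix e :: real assume "0 < e"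
    then obtain N where N: "norm (X m - X n) < e / 2" if "m \<ge> N" "n \<ge> N" for m n
      using CauchyD[OF X, of "e / 2"] by auto
    have "norm (X n - Blinfun L) \<le> e / 2" if "n \<ge> N" for n
    proof (rule norm_blinfun_bound)
      fix x
      have "(\<lambda>k. norm (X n x - X k x)) \<longlonglongrightarrow> norm (X n x - L x)"
        by (intro tendsto_intros L)
      moreover have "norm (X n x - X k x) \<le> e / 2 * norm x" if "k \<ge> N" for k
        using norm_blinfun[of "X n - X k" x] N[OF \<open>n \<ge> N\<close> that]
          mult_right_mono[of "norm (X n - X k)" "e / 2" "norm x"]
        by (simp add: blinfun.diff_left)
      ultimately show "norm ((X n - Blinfun L) x) \<le> e / 2 * norm x"
        unfolding blinfun.diff_left BL by (blast intro: LIMSEQ_le_const2)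
    qed (use \<open>0 < e\<close> in simp)
    then show "\<exists>N. \<forall>n\<ge>N. norm (X n - Blinfun L) < e"
      using \<open>0 < e\<close> by (intro exI[of _ N]) (smt (verit) field_sum_of_halves)
  qed
  then show "\<exists>l\<in>UNIV. X \<longlonglongrightarrow> l" by blast
qed

section \<open>Riesz representation of functionals and forms\<close>

text \<open>
  The representing vector is the minimiser of the energy \<open>E x = \<parallel>x\<parallel>\<^sup>2 - 2 f x\<close>. The parallelogram
  law makes minimising sequences Cauchy, and the vanishing of the first variation of \<open>E\<close> at the
  minimiser is the equation \<open>\<langle>z, y\<rangle> = f y\<close>.
\<close>
lemma Riesz_representation:
  fixes f :: "'h::{real_inner,complete_space} \<Rightarrow> real"
  assumes "bounded_linear f"
  shows "\<exists>z. \<forall>y. inner z y = f y"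
proof -
  interpret f: bounded_linear f by fact
  define E where "E x = (norm x)\<^sup>2 - 2 * f x" for x
  obtain K where K: "\<bar>f x\<bar> \<le> norm x * K" for x
    using f.bounded by auto
  have "E x \<ge> - K\<^sup>2" for x
    using K[of x] zero_le_power2[of "norm x - K"]
    by (simp add: E_def power2_diff mult.commute)
  then have bdd: "bdd_below (range E)"
    by (intro bdd_belowI[of _ "- K\<^sup>2"]) auto
  define d where "d = Inf (range E)"
  have d: "d \<le> E x" for x
    unfolding d_def using bdd by (intro cInf_lower) auto
  have "\<exists>x. E x < d + 1 / Suc n" for n
    using cInf_lessD[of "range E" "d + 1 / Suc n"] by (auto simp: d_def)
  then obtain x where x: "E (x n) < d + 1 / Suc n" for n
    by metis
  have mid: "(norm (a - b))\<^sup>2 \<le> 2 * (E a - d) + 2 * (E b - d)" for a b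
  proof -
    have "(norm (a - b))\<^sup>2 = 2 * E a + 2 * E b - 4 * E ((1/2) *\<^sub>R (a + b))"
      by (simp add: E_def power2_norm_eq_inner f.add f.scaleR inner_diff_left inner_diff_right
          inner_add_left inner_add_right inner_commute algebra_simps)
    then show ?thesis using d[of "(1/2) *\<^sub>R (a + b)"] by simp
  qed
  have "Cauchy x"
  proof (rule CauchyI)
    fix e :: real assume "0 < e"
    then obtain N where N: "4 / Suc N < e\<^sup>2"
      using reals_Archimedean[of "e\<^sup>2 / 4"] by (auto simp: field_simps)
    have less: "E (x n) - d < 1 / Suc N" if "n \<ge> N" for n
      using x[of n] that frac_le[of 1 1 "real (Suc N)" "real (Suc n)"] by simp
    have "norm (x m - x n) < e" if "m \<ge> N" "n \<ge> N" for m n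
    proof (rule power2_less_imp_less)
      show "(norm (x m - x n))\<^sup>2 < e\<^sup>2"
        using mid[of "x m" "x n"] less[OF that(1)] less[OF that(2)] N by simp
    qed (use \<open>0 < e\<close> in simp)
    then show "\<exists>N. \<forall>m\<ge>N. \<forall>n\<ge>N. norm (x m - x n) < e" by blast
  qed
  then obtain z where z: "x \<longlonglongrightarrow> z"
    using Cauchy_convergent by (auto simp: convergent_def)
  have "(\<lambda>n. E (x n)) \<longlonglongrightarrow> E z"
    unfolding E_def by (intro tendsto_intros z f.tendsto)
  moreover have "(\<lambda>n. d + 1 / Suc n) \<longlonglongrightarrow> d + 0"
    by (intro tendsto_intros LIMSEQ_Suc lim_1_over_n)
  ultimately have "E z \<le> d + 0"
    using x by (intro LIMSEQ_le) (auto intro: less_imp_le)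
  with d have min: "E z \<le> E y" for y
    by (smt (verit))
  have "inner z y = f y" for y
  proof -
    define a where "a = inner z y - f y"
    have "0 \<le> 2 * t * a + t\<^sup>2 * (norm y)\<^sup>2" for t
    proof -
      have "E (z + t *\<^sub>R y) = E z + (2 * t * a + t\<^sup>2 * (norm y)\<^sup>2)"
        unfolding power2_norm_eq_inner E_def a_def
        by (simp add: f.add f.scaleR inner_add_left inner_add_right inner_commute
            power2_eq_square algebra_simps)
      then show ?thesis using min[of "z + t *\<^sub>R y"] by simp
    qed
    \<comment> \<open>For \<open>a \<noteq> 0\<close> the quadratic in \<open>t\<close> is negative here; the added \<open>1\<close> also covers \<open>y = 0\<close>.\<close>
    from this[of "- a / ((norm y)\<^sup>2 + 1)"]
    have "0 \<le> 2 * (- a / ((norm y)\<^sup>2 + 1)) * a + (- a / ((norm y)\<^sup>2 + 1))\<^sup>2 * (norm y)\<^sup>2" .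
    also have "\<dots> = - (a\<^sup>2 * ((norm y)\<^sup>2 + 2)) / ((norm y)\<^sup>2 + 1)\<^sup>2"
      by (simp add: divide_simps add_nonneg_eq_0_iff) (simp add: algebra_simps power2_eq_square)
    finally have "a\<^sup>2 * ((norm y)\<^sup>2 + 2) \<le> 0"
      by (simp add: divide_le_0_iff zero_le_divide_iff add_nonneg_eq_0_iff)
    then have "a = 0"
      by (smt (verit) mult_pos_pos zero_le_power2 zero_less_power2)
    then show ?thesis by (simp add: a_def)
  qed
  then show ?thesis by blast
qed

lemma bounded_bilinear_form_operator:
  fixes B :: "'h::{real_inner,complete_space} \<Rightarrow> 'h \<Rightarrow> real"
  assumes "bounded_bilinear B"
  obtains P :: "'h \<Rightarrow>\<^sub>L 'h" where "\<And>x y. inner (P x) y = B x y"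
proof -
  interpret B: bounded_bilinear B by fact
  obtain p where p: "inner (p x) y = B x y" for x y
    using Riesz_representation[OF B.bounded_linear_right] by metis
  obtain K where K: "\<bar>B x y\<bar> \<le> norm x * norm y * K" for x y
    using B.bounded by auto
  have "bounded_linear p"
  proof (rule bounded_linear_intro)
    show "p (x + y) = p x + p y" for x y
      by (subst vector_eq_rdot[symmetric]) (simp add: p inner_add_left B.add_left)
    show "p (c *\<^sub>R x) = c *\<^sub>R p x" for c x
      by (subst vector_eq_rdot[symmetric]) (simp add: p B.scaleR_left)
    show "norm (p x) \<le> norm x * K" for x
    proof (cases "p x = 0")
      case True
      have "0 \<le> norm x * norm x * K" using K[of x x] by linarith
      then have "0 \<le> norm x * K"
        by (cases "x = 0") (auto simp: zero_le_mult_iff mult_le_0_iff)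
      then show ?thesis by (simp add: True)
    next
      case False
      have "norm (p x) * norm (p x) = B x (p x)"
        by (metis p power2_eq_square power2_norm_eq_inner)
      also have "\<dots> \<le> norm x * K * norm (p x)"
        using K[of x "p x"] by (simp add: mult_ac)
      finally show ?thesis using False by simp
    qed
  qed
  then show ?thesis
    using that[of "Blinfun p"] p by (simp add: bounded_linear_Blinfun_apply)
qed

section \<open>Square roots of strictly positive operators\<close>

text \<open>
  Polarisation bounds \<open>4 \<langle>X x, v\<rangle>\<close> by \<open>q \<parallel>x + v\<parallel>\<^sup>2\<close>, since positivity allows the term
  with \<open>x - v\<close> to be dropped. Choosing \<open>v\<close> parallel to \<open>X x\<close> and as long as \<open>x\<close> turns this into a
  bound on \<open>\<parallel>X x\<parallel>\<close>.
\<close>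
lemma norm_le_quadratic_form_bound:
  fixes X :: "'h::real_inner \<Rightarrow>\<^sub>L 'h"
  assumes "selfadjoint_op X" and X: "\<And>x. 0 \<le> inner (X x) x" "\<And>x. inner (X x) x \<le> q * (norm x)\<^sup>2"
    and "0 \<le> q"
  shows "norm X \<le> q"
proof (rule norm_blinfun_bound)
  fix x
  show "norm (X x) \<le> q * norm x"
  proof (cases "X x = 0 \<or> x = 0")
    case True
    then show ?thesis using \<open>0 \<le> q\<close> by (auto simp: blinfun.zero_right)
  next
    case False
    define v where "v = (norm x / norm (X x)) *\<^sub>R X x"
    have v: "norm v = norm x" "inner (X x) v = norm (X x) * norm x"
      using False by (simp_all add: v_def flip: power2_norm_eq_inner) (simp add: power2_eq_square)
    have "4 * inner (X x) v = inner (X (x + v)) (x + v) - inner (X (x - v)) (x - v)"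
      using \<open>selfadjoint_op X\<close>
      by (simp add: selfadjoint_op_def blinfun.add_right blinfun.diff_right inner_add_left
          inner_add_right inner_diff_left inner_diff_right inner_commute)
    also have "\<dots> \<le> q * (norm (x + v))\<^sup>2"
      using X(1)[of "x - v"] X(2)[of "x + v"] by simp
    also have "\<dots> \<le> q * (2 * norm x)\<^sup>2"
      using norm_triangle_ineq[of x v] \<open>0 \<le> q\<close> v(1)
      by (intro mult_left_mono power_mono) auto
    finally show ?thesis
      using False by (simp add: v(2) power2_eq_square)
  qed
qed fact

text \<open>
  The equations \<open>Z = I + Y Z\<close> and \<open>W = I + W Y\<close> say that \<open>Z\<close> and \<open>W\<close> are a right and a left inverse
  of \<open>I - Y\<close>; both are fixed point equations of contractions with constant \<open>\<parallel>Y\<parallel>\<close>.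
\<close>
lemma invertible_one_minus:
  fixes Y :: "'h::{real_normed_vector,complete_space} \<Rightarrow>\<^sub>L 'h"
  assumes "norm Y < 1"
  shows "invertible_op (id_blinfun - Y)"
proof -
  note simps = blinfun.diff_left blinfun.add_left blinfun.diff_right blinfun.add_right
  have "\<exists>!Z. Z \<in> UNIV \<and> id_blinfun + (Y o\<^sub>L Z) = Z"
  proof (rule Banach_fix[OF complete_UNIV_blinfun _ norm_ge_zero assms])
    fix U V :: "'h \<Rightarrow>\<^sub>L 'h"
    have "id_blinfun + (Y o\<^sub>L U) - (id_blinfun + (Y o\<^sub>L V)) = Y o\<^sub>L (U - V)"
      by (rule blinfun_eqI) (simp add: simps)
    then show "dist (id_blinfun + (Y o\<^sub>L U)) (id_blinfun + (Y o\<^sub>L V)) \<le> norm Y * dist U V"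
      by (simp add: dist_norm norm_blinfun_compose)
  qed auto
  then obtain Z where Z: "id_blinfun + (Y o\<^sub>L Z) = Z" by blast
  have "\<exists>!W. W \<in> UNIV \<and> id_blinfun + (W o\<^sub>L Y) = W"
  proof (rule Banach_fix[OF complete_UNIV_blinfun _ norm_ge_zero assms])
    fix U V :: "'h \<Rightarrow>\<^sub>L 'h"
    have "id_blinfun + (U o\<^sub>L Y) - (id_blinfun + (V o\<^sub>L Y)) = (U - V) o\<^sub>L Y"
      by (rule blinfun_eqI) (simp add: simps)
    then show "dist (id_blinfun + (U o\<^sub>L Y)) (id_blinfun + (V o\<^sub>L Y)) \<le> norm Y * dist U V"
      by (metis dist_norm mult.commute norm_blinfun_compose)
  qed auto
  then obtain W where W: "id_blinfun + (W o\<^sub>L Y) = W" by blast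
  have Z': "Z x - Y (Z x) = x" for x
    using arg_cong[OF Z, of "\<lambda>B. B x"] by (simp add: simps algebra_simps)
  have W': "W (x - Y x) = x" for x
    using arg_cong[OF W, of "\<lambda>B. B x"] by (simp add: simps algebra_simps)
  have WZ: "W x = Z x" for x
    using W'[of "Z x"] Z'[of x] by simp
  show ?thesis
    unfolding invertible_op_def
    by (intro exI[of _ Z] conjI blinfun_eqI) (simp_all add: simps Z', metis W' WZ simps(3))
qed

text \<open>
  The equation \<open>(I - Y)\<^sup>2 = I - X\<close> is equivalent to \<open>Y = (X + Y\<^sup>2) / 2\<close>. The radius \<open>r = 1 - c\<close> is
  the smaller solution of the scalar equation \<open>r = ((1 - c\<^sup>2) + r\<^sup>2) / 2\<close>, so the ball of radius
  \<open>r\<close> is mapped into itself, with Lipschitz constant \<open>r < 1\<close>. Self-adjointness, positivity and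
  membership in the bicommutant of \<open>X\<close> are closed conditions which the map preserves, so
  the fixed point inherits them.
\<close>
lemma contractive_root_of_one_minus:
  fixes X :: "'h::{real_inner,complete_space} \<Rightarrow>\<^sub>L 'h"
  assumes "selfadjoint_op X" and "\<And>x. 0 \<le> inner (X x) x"
    and "norm X \<le> 1 - c\<^sup>2" and "0 < c" "c \<le> 1"
  obtains Y where "selfadjoint_op Y" and "\<And>x. 0 \<le> inner (Y x) x" and "norm Y \<le> 1 - c"
    and "(id_blinfun - Y) o\<^sub>L (id_blinfun - Y) = id_blinfun - X"
    and "\<And>J. J o\<^sub>L X = X o\<^sub>L J \<Longrightarrow> J o\<^sub>L Y = Y o\<^sub>L J"
proof -
  note simps = blinfun.diff_left blinfun.add_left blinfun.diff_right blinfun.add_right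
    blinfun.scaleR_left blinfun.scaleR_right
  define S where "S = {Y :: 'h \<Rightarrow>\<^sub>L 'h. norm Y \<le> 1 - c \<and>
    (\<forall>x y. inner (blinfun_apply Y x) y = inner x (Y y)) \<and> (\<forall>x. 0 \<le> inner (Y x) x) \<and>
    (\<forall>J. J o\<^sub>L X = X o\<^sub>L J \<longrightarrow> (\<forall>x. J (Y x) = Y (J x)))}"
  define F where "F Y = (1/2) *\<^sub>R (X + (Y o\<^sub>L Y))" for Y :: "'h \<Rightarrow>\<^sub>L 'h"
  have "closed S"
    unfolding S_def
    by (intro closed_Collect_conj closed_Collect_all closed_Collect_eq closed_Collect_le
        closed_Collect_imp open_Collect_const continuous_intros)
  then have "complete S"
    using complete_UNIV_blinfun complete_closed_subset[of S UNIV] by auto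
  moreover have "0 \<in> S"
    using \<open>c \<le> 1\<close> by (simp add: S_def blinfun.zero_right)
  moreover have "F Y \<in> S" if "Y \<in> S" for Y
  proof -
    from that have Y: "inner (Y x) y = inner x (Y y)" "norm Y \<le> 1 - c"
      "J o\<^sub>L X = X o\<^sub>L J \<Longrightarrow> J (Y x) = Y (J x)" for x y J
      by (auto simp: S_def)
    have "norm (F Y) \<le> (norm X + norm Y * norm Y) / 2"
      using norm_triangle_ineq[of X "Y o\<^sub>L Y"] norm_blinfun_compose[of Y Y] by (simp add: F_def)
    also have "\<dots> \<le> (1 - c\<^sup>2 + (1 - c) * (1 - c)) / 2"
      using assms(3) mult_mono[OF Y(2) Y(2)] \<open>c \<le> 1\<close> by simp
    also have "\<dots> = 1 - c"
      by (simp add: power2_eq_square field_simps)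
    finally have "norm (F Y) \<le> 1 - c" .
    moreover have "inner (F Y x) y = inner x (F Y y)" for x y
      using assms(1) by (simp add: F_def simps inner_add_left inner_add_right Y(1) selfadjoint_op_def)
    moreover have "0 \<le> inner (F Y x) x" for x
      using assms(2)[of x] Y(1)[of "Y x" x] by (simp add: F_def simps inner_add_left)
    moreover have "J (F Y x) = F Y (J x)" if "J o\<^sub>L X = X o\<^sub>L J" for J x
      using Y(3)[OF that] arg_cong[OF that, of "\<lambda>B. B x"] by (simp add: F_def simps)
    ultimately show ?thesis by (auto simp: S_def)
  qed
  moreover have "dist (F U) (F V) \<le> (1 - c) * dist U V" if "U \<in> S" "V \<in> S" for U V
  proof -
    \<comment> \<open>The noncommutative factorisation \<open>U\<^sup>2 - V\<^sup>2 = U (U - V) + (U - V) V\<close>.\<close>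
    have "F U - F V = (1/2) *\<^sub>R ((U o\<^sub>L (U - V)) + ((U - V) o\<^sub>L V))"
      by (rule blinfun_eqI) (simp add: F_def simps algebra_simps)
    then have "norm (F U - F V) \<le> (norm U * norm (U - V) + norm (U - V) * norm V) / 2"
      using norm_triangle_ineq[of "U o\<^sub>L (U - V)" "(U - V) o\<^sub>L V"]
        norm_blinfun_compose[of U "U - V"] norm_blinfun_compose[of "U - V" V] by simp
    also have "\<dots> \<le> ((1 - c) * norm (U - V) + norm (U - V) * (1 - c)) / 2"
      using that \<open>c \<le> 1\<close> by (intro divide_right_mono add_mono mult_mono) (auto simp: S_def)
    finally show ?thesis by (simp add: dist_norm mult.commute)
  qed
  ultimately have "\<exists>!Y\<in>S. F Y = Y"
    using \<open>0 < c\<close> \<open>c \<le> 1\<close> by (intro Banach_fix[where c = "1 - c"]) auto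
  then obtain Y where Y: "Y \<in> S" "F Y = Y" by blast
  show ?thesis
  proof
    show "(id_blinfun - Y) o\<^sub>L (id_blinfun - Y) = id_blinfun - X"
    proof (rule blinfun_eqI)
      fix x
      have "2 *\<^sub>R F Y x = X x + Y (Y x)"
        by (simp add: F_def simps)
      then have "Y x + Y x = X x + Y (Y x)"
        by (simp add: Y(2) scaleR_2)
      then show "((id_blinfun - Y) o\<^sub>L (id_blinfun - Y)) x = (id_blinfun - X) x"
        by (simp add: simps algebra_simps)
    qed
    show "J o\<^sub>L Y = Y o\<^sub>L J" if "J o\<^sub>L X = X o\<^sub>L J" for J
      using Y(1) that by (auto simp: S_def intro: blinfun_eqI)
  qed (use Y(1) in \<open>auto simp: S_def selfadjoint_op_def\<close>)
qed

text \<open>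
  For \<open>A = M (I - Y)\<close> the upper bound \<open>A \<le> M I\<close> is \<open>Y \<ge> 0\<close>, and the lower bound \<open>m I \<le> A\<close> is
  implied by \<open>\<parallel>Y\<parallel> \<le> 1 - m / M\<close>.
\<close>
lemma positive_square_root:
  fixes P :: "'h::{real_inner,complete_space} \<Rightarrow>\<^sub>L 'h"
  assumes "selfadjoint_op P" and "0 < m" "m \<le> M"
    and P: "\<And>x. m\<^sup>2 * (norm x)\<^sup>2 \<le> inner (P x) x" "\<And>x. inner (P x) x \<le> M\<^sup>2 * (norm x)\<^sup>2"
  obtains A where "selfadjoint_op A" and "invertible_op A" and "A o\<^sub>L A = P"
    and "\<And>x. m * (norm x)\<^sup>2 \<le> inner (A x) x" and "\<And>x. inner (A x) x \<le> M * (norm x)\<^sup>2"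
    and "\<And>J. J o\<^sub>L P = P o\<^sub>L J \<Longrightarrow> J o\<^sub>L A = A o\<^sub>L J"
proof -
  note simps = blinfun.diff_left blinfun.add_left blinfun.diff_right blinfun.add_right
    blinfun.scaleR_left blinfun.scaleR_right
  define c where "c = m / M"
  have "0 < M" and c: "0 < c" "c \<le> 1" using assms(2,3) by (auto simp: c_def)
  define X where "X = id_blinfun - (1 / M\<^sup>2) *\<^sub>R P"
  have Xq: "inner (X x) x = (norm x)\<^sup>2 - inner (P x) x / M\<^sup>2" for x
    by (simp add: X_def simps inner_diff_left power2_norm_eq_inner)
  have X: "selfadjoint_op X"
    using assms(1) by (simp add: selfadjoint_op_def X_def simps inner_diff_left inner_diff_right)
  have X0: "0 \<le> inner (X x) x" for x
    using P(2)[of x] \<open>0 < M\<close> by (simp add: Xq field_simps)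
  have "inner (X x) x \<le> (1 - c\<^sup>2) * (norm x)\<^sup>2" for x
    using P(1)[of x] \<open>0 < M\<close> by (simp add: Xq c_def field_simps)
  then have "norm X \<le> 1 - c\<^sup>2"
    using X X0 c by (intro norm_le_quadratic_form_bound) (auto simp: power_le_one)
  \<comment> \<open>The lower bound on \<open>P\<close> has become the gap between the norm of \<open>X\<close> and 1 that the fixed point needs.\<close>
  from contractive_root_of_one_minus[OF X X0 this c]
  obtain Y where Y: "selfadjoint_op Y" "\<And>x. 0 \<le> inner (Y x) x" "norm Y \<le> 1 - c"
    and sq: "(id_blinfun - Y) o\<^sub>L (id_blinfun - Y) = id_blinfun - X"
    and comm: "\<And>J. J o\<^sub>L X = X o\<^sub>L J \<Longrightarrow> J o\<^sub>L Y = Y o\<^sub>L J"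
    by blast
  define A where "A = M *\<^sub>R (id_blinfun - Y)"
  have Aq: "inner (A x) x = M * (norm x)\<^sup>2 - M * inner (Y x) x" for x
    by (simp add: A_def simps inner_diff_left power2_norm_eq_inner algebra_simps)
  show ?thesis
  proof
    show "selfadjoint_op A"
      using Y(1) by (simp add: selfadjoint_op_def A_def simps inner_diff_left inner_diff_right)
    obtain B where B: "(id_blinfun - Y) o\<^sub>L B = id_blinfun" "B o\<^sub>L (id_blinfun - Y) = id_blinfun"
      using invertible_one_minus[of Y] Y(3) c(1) by (auto simp: invertible_op_def)
    show "invertible_op A"
      unfolding invertible_op_def
    proof (intro exI[of _ "(1 / M) *\<^sub>R B"] conjI blinfun_eqI)
      fix x
      show "(A o\<^sub>L (1 / M) *\<^sub>R B) x = id_blinfun x"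
        using arg_cong[OF B(1), of "\<lambda>B. B x"] \<open>0 < M\<close> by (simp add: A_def simps)
      show "((1 / M) *\<^sub>R B o\<^sub>L A) x = id_blinfun x"
        using arg_cong[OF B(2), of "\<lambda>B. B x"] \<open>0 < M\<close>
        by (simp add: A_def simps flip: scaleR_diff_right)
    qed
    show "A o\<^sub>L A = P"
    proof (rule blinfun_eqI)
      fix x
      have "A (A x) = M\<^sup>2 *\<^sub>R ((id_blinfun - Y) o\<^sub>L (id_blinfun - Y)) x"
        by (simp add: A_def simps power2_eq_square algebra_simps)
      also have "\<dots> = P x"
        unfolding sq using \<open>0 < M\<close> by (simp add: X_def simps)
      finally show "(A o\<^sub>L A) x = P x" by simp
    qed
    show "inner (A x) x \<le> M * (norm x)\<^sup>2" for x
      using Y(2)[of x] \<open>0 < M\<close> by (simp add: Aq)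
    show "m * (norm x)\<^sup>2 \<le> inner (A x) x" for x
    proof -
      have "inner (Y x) x \<le> norm (Y x) * norm x"
        by (rule norm_cauchy_schwarz)
      also have "\<dots> \<le> norm Y * norm x * norm x"
        by (intro mult_right_mono norm_blinfun) simp
      also have "\<dots> \<le> (1 - c) * (norm x)\<^sup>2"
        using mult_right_mono[OF Y(3), of "(norm x)\<^sup>2"] by (simp add: power2_eq_square mult_ac)
      finally have "M * inner (Y x) x \<le> M * ((1 - c) * (norm x)\<^sup>2)"
        using \<open>0 < M\<close> by simp
      also have "\<dots> = M * (norm x)\<^sup>2 - m * (norm x)\<^sup>2"
        using \<open>0 < M\<close> by (simp add: c_def field_simps)
      finally show ?thesis by (simp add: Aq)
    qed
    show "J o\<^sub>L A = A o\<^sub>L J" if "J o\<^sub>L P = P o\<^sub>L J" for J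
    proof -
      have "J (P x) = P (J x)" for x
        using arg_cong[OF that, of "\<lambda>B. B x"] by simp
      then have "J o\<^sub>L X = X o\<^sub>L J"
        by (intro blinfun_eqI) (simp add: X_def simps)
      then have "J o\<^sub>L Y = Y o\<^sub>L J" by (rule comm)
      then have "J (Y x) = Y (J x)" for x
        by (metis blinfun_apply_blinfun_compose)
      then show ?thesis
        by (intro blinfun_eqI) (simp add: A_def simps)
    qed
  qed
qed

section \<open>Averaging the matrix coefficients\<close>

text \<open>
  \<^const>\<open>Bcontfun\<close> is meaningful here when \<open>T\<close> is strongly continuous and uniformly bounded
  (\<open>apply_matrix_coeff\<close> below).
\<close>
definition matrix_coeff ::
  "('s::topological_space \<Rightarrow> ('h::real_inner \<Rightarrow>\<^sub>L 'h)) \<Rightarrow> 'h \<Rightarrow> 'h \<Rightarrow> ('s \<Rightarrow>\<^sub>C real)" where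
  "matrix_coeff T x y = Bcontfun (\<lambda>s. inner (T s x) (T s y))"

lemma inner_bounded_ops_le:
  assumes "\<And>x. norm (A x) \<le> M * norm x"
  shows "\<bar>inner (A x) (A y)\<bar> \<le> norm x * norm y * M\<^sup>2"
proof -
  have "\<bar>inner (A x) (A y)\<bar> \<le> norm (A x) * norm (A y)"
    by (rule Cauchy_Schwarz_ineq2)
  also have "\<dots> \<le> (M * norm x) * (M * norm y)"
    by (rule mult_mono[OF assms assms]) (use order_trans[OF norm_ge_zero assms] in auto)
  finally show ?thesis by (simp add: power2_eq_square mult_ac)
qed

lemma apply_matrix_coeff:
  fixes T :: "'s::topological_space \<Rightarrow> ('h::real_inner \<Rightarrow>\<^sub>L 'h)"
  assumes "\<And>x. continuous_on UNIV (\<lambda>s. T s x)" and "\<And>s x. norm (T s x) \<le> M * norm x"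
  shows "apply_bcontfun (matrix_coeff T x y) s = inner (T s x) (T s y)"
proof -
  have "(\<lambda>s. inner (T s x) (T s y)) \<in> bcontfun"
    by (rule bcontfun_normI[where b = "norm x * norm y * M\<^sup>2"])
      (auto intro!: continuous_intros assms(1) inner_bounded_ops_le assms(2))
  then show ?thesis
    by (simp add: matrix_coeff_def Bcontfun_inverse)
qed

text \<open>
  Boundedness in the supremum norm is what turns strong continuity of \<open>T\<close> into the norm
  continuity of translates demanded by \<^const>\<open>C_norm\<close>.
\<close>
lemma bounded_bilinear_matrix_coeff:
  fixes T :: "'s::topological_space \<Rightarrow> ('h::real_inner \<Rightarrow>\<^sub>L 'h)"
  assumes "\<And>x. continuous_on UNIV (\<lambda>s. T s x)" and "\<And>s x. norm (T s x) \<le> M * norm x"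
  shows "bounded_bilinear (matrix_coeff T)"
proof -
  note coeff = apply_matrix_coeff[OF assms]
  have "norm (matrix_coeff T x y) \<le> norm x * norm y * M\<^sup>2" for x y
    using inner_bounded_ops_le[OF assms(2)] by (intro norm_bound) (simp add: coeff)
  then show ?thesis
    by unfold_locales
      (auto intro!: bcontfun_eqI simp: coeff blinfun.add_right blinfun.scaleR_right
        inner_add_left inner_add_right)
qed

text \<open>
  Since \<open>T\<^sub>t\<^sub>s = T\<^sub>t T\<^sub>s\<close>, right translation by \<open>s\<close> acts on the two vectors of a matrix coefficient by
  \<open>T\<^sub>s\<close>. Norm continuity of the translates then reduces to continuity of a bounded bilinear map
  along the orbits \<open>s \<mapsto> T\<^sub>s x\<close>.
\<close>
lemma matrix_coeff_translates:
  fixes T :: "'s::{semigroup_mult,topological_space} \<Rightarrow> ('h::real_inner \<Rightarrow>\<^sub>L 'h)"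
  assumes hom: "\<And>s t. T (s * t) = T s o\<^sub>L T t"
    and cont: "\<And>x. continuous_on UNIV (\<lambda>s. T s x)"
    and bound: "\<And>s x. norm (T s x) \<le> M * norm x"
  shows "rtranslate (matrix_coeff T x y) s = matrix_coeff T (T s x) (T s y)"
    and "matrix_coeff T x y \<in> C_norm"
proof -
  note coeff = apply_matrix_coeff[OF cont bound]
  have C_r: "matrix_coeff T x y \<in> C_r" for x y
    unfolding C_r_def by (auto simp: coeff hom intro!: continuous_intros cont)
  show trans: "rtranslate (matrix_coeff T x y) s = matrix_coeff T (T s x) (T s y)" for s
    by (rule bcontfun_eqI) (simp add: apply_rtranslate[OF C_r] coeff hom)
  show "matrix_coeff T x y \<in> C_norm"
    unfolding C_norm_def
    by (auto simp: C_r trans hom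
        intro!: bounded_bilinear.continuous_on[OF bounded_bilinear_matrix_coeff[OF cont bound]] cont)
qed

text \<open>
  The form is the mean of the matrix coefficients. An isometry \<open>J\<close> commuting with \<open>T\<close> does not
  change any matrix coefficient, which is why it preserves \<open>B\<close>; multiplication by \<open>\<i>\<close> will be
  such a \<open>J\<close>.
\<close>
lemma invariant_form:
  fixes T :: "'s::{semigroup_mult,topological_space} \<Rightarrow> ('h::real_inner \<Rightarrow>\<^sub>L 'h)"
  assumes amenable: "weakly_right_amenable TYPE('s)"
    and hom: "\<And>s t. T (s * t) = T s o\<^sub>L T t"
    and cont: "\<And>x. continuous_on UNIV (\<lambda>s. T s x)"
    and bounds: "\<And>s x. m * norm x \<le> norm (T s x)" "\<And>s x. norm (T s x) \<le> M * norm x"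
    and "0 \<le> m"
  obtains B where "bounded_bilinear B" and "\<And>x y. B x y = B y x" and "\<And>s x y. B (T s x) (T s y) = B x y"
    and "\<And>x. m\<^sup>2 * (norm x)\<^sup>2 \<le> B x x" and "\<And>x. B x x \<le> M\<^sup>2 * (norm x)\<^sup>2"
    and "\<And>J x y. (\<And>x y. inner (J x) (J y) = inner x y) \<Longrightarrow> (\<And>s x. T s (J x) = J (T s x)) \<Longrightarrow>
           B (J x) (J y) = B x y"
proof -
  obtain \<phi> :: "('s \<Rightarrow>\<^sub>C real) \<Rightarrow> real" where "right_invariant_mean \<phi>"
    using amenable by (auto simp: weakly_right_amenable_def)
  then have add: "f \<in> C_norm \<Longrightarrow> g \<in> C_norm \<Longrightarrow> \<phi> (f + g) = \<phi> f + \<phi> g"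
    and scale: "f \<in> C_norm \<Longrightarrow> \<phi> (c *\<^sub>R f) = c * \<phi> f"
    and inf: "f \<in> C_norm \<Longrightarrow> (INF t. apply_bcontfun f t) \<le> \<phi> f"
    and sup: "f \<in> C_norm \<Longrightarrow> \<phi> f \<le> (SUP t. apply_bcontfun f t)"
    and invariant: "f \<in> C_norm \<Longrightarrow> \<phi> (rtranslate f s) = \<phi> f" for f g c s
    by (auto simp: right_invariant_mean_def)
  have between: "a \<le> \<phi> f" "\<phi> f \<le> b"
    if f: "f \<in> C_norm" and ab: "\<And>t. a \<le> apply_bcontfun f t" "\<And>t. apply_bcontfun f t \<le> b" for a b f
    using inf[OF f] sup[OF f] cINF_greatest[where f = "apply_bcontfun f", OF UNIV_not_empty ab(1)]
      cSUP_least[where f = "apply_bcontfun f", OF UNIV_not_empty ab(2)]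
    by linarith+
  note coeff = apply_matrix_coeff[OF cont bounds(2)]
  note trans = matrix_coeff_translates[OF hom cont bounds(2)]
  interpret mc: bounded_bilinear "matrix_coeff T"
    by (rule bounded_bilinear_matrix_coeff[OF cont bounds(2)])
  define B where "B x y = \<phi> (matrix_coeff T x y)" for x y
  show ?thesis
  proof
    have "\<bar>B x y\<bar> \<le> norm x * norm y * M\<^sup>2" for x y
    proof -
      have "\<bar>apply_bcontfun (matrix_coeff T x y) s\<bar> \<le> norm x * norm y * M\<^sup>2" for s
        unfolding coeff by (rule inner_bounded_ops_le[OF bounds(2)])
      then show ?thesis
        using between[OF trans(2), of "- (norm x * norm y * M\<^sup>2)" x y "norm x * norm y * M\<^sup>2"]
        by (simp add: B_def abs_le_iff minus_le_iff)
    qed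
    then show "bounded_bilinear B"
      by unfold_locales
        (auto simp: B_def mc.add_left mc.add_right mc.scaleR_left mc.scaleR_right add scale trans(2))
    show "B x y = B y x" for x y
      by (simp add: B_def matrix_coeff_def inner_commute)
    show "B (T s x) (T s y) = B x y" for s x y
      unfolding B_def trans(1)[symmetric] by (rule invariant[OF trans(2)])
    have square: "m\<^sup>2 * (norm x)\<^sup>2 \<le> inner (T s x) (T s x)"
      "inner (T s x) (T s x) \<le> M\<^sup>2 * (norm x)\<^sup>2" for s x
      using power_mono[OF bounds(1)[where s = s and x = x], of 2]
        power_mono[OF bounds(2)[where s = s and x = x], of 2] \<open>0 \<le> m\<close>
      by (simp_all add: power_mult_distrib power2_norm_eq_inner)
    show "m\<^sup>2 * (norm x)\<^sup>2 \<le> B x x" "B x x \<le> M\<^sup>2 * (norm x)\<^sup>2" for x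
      unfolding B_def by (rule between[OF trans(2)]; unfold coeff; rule square)+
    show "B (J x) (J y) = B x y"
      if "\<And>x y. inner (J x) (J y) = inner x y" "\<And>s x. T s (J x) = J (T s x)" for J x y
      by (simp add: B_def matrix_coeff_def that)
  qed
qed

section \<open>Similarity to a semigroup of isometries\<close>

text \<open>
  \<open>A\<close> is the square root of the operator \<open>P\<close> representing the invariant form, so that
  \<open>\<langle>A x, A y\<rangle> = B(x, y)\<close>. The last conclusion says that \<open>A\<close> respects every additional structure of
  the space that is given by surjective isometries commuting with \<open>T\<close>.
\<close>
lemma similar_to_isometries:
  fixes T :: "'s::{semigroup_mult,topological_space} \<Rightarrow> ('h::{real_inner,complete_space} \<Rightarrow>\<^sub>L 'h)"
  assumes amenable: "weakly_right_amenable TYPE('s)"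
    and hom: "\<And>s t. T (s * t) = T s o\<^sub>L T t"
    and cont: "continuous_map euclidean strong_operator_topology T"
    and bounds: "\<And>s x. m * norm x \<le> norm (T s x)" "\<And>s x. norm (T s x) \<le> M * norm x"
    and pos: "0 < m" "0 < M"
  obtains A :: "'h \<Rightarrow>\<^sub>L 'h" where "selfadjoint_op A" and "invertible_op A"
    and "\<And>s. isometry_op (A o\<^sub>L T s o\<^sub>L inverse_op A)"
    and "\<And>x. m * (norm x)\<^sup>2 \<le> inner (A x) x" and "\<And>x. inner (A x) x \<le> M * (norm x)\<^sup>2"
    and "\<And>J :: 'h \<Rightarrow>\<^sub>L 'h. (\<And>s. T s o\<^sub>L J = J o\<^sub>L T s) \<Longrightarrow>
           (\<And>x y. inner (J x) (J y) = inner x y) \<Longrightarrow> surj J \<Longrightarrow> J o\<^sub>L A = A o\<^sub>L J"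
proof -
  \<comment> \<open>On the zero space the hypotheses do not force \<open>m \<le> M\<close>, which the square root needs.\<close>
  define m' where "m' = min m M"
  have m': "0 < m'" "m' \<le> M" "m' * norm x \<le> norm (T s x)" for s x
    using pos bounds(1)[of x s] mult_right_mono[of m' m "norm x"] by (auto simp: m'_def)
  have cont': "continuous_on UNIV (\<lambda>s. T s x)" for x
    using cont by (simp add: continuous_on_strong_operator_topo_iff_coordinatewise)
  obtain B where "bounded_bilinear B" and B: "\<And>x y. B x y = B y x" "\<And>s x y. B (T s x) (T s y) = B x y"
    "\<And>x. m'\<^sup>2 * (norm x)\<^sup>2 \<le> B x x" "\<And>x. B x x \<le> M\<^sup>2 * (norm x)\<^sup>2"
    and BJ: "\<And>J x y. (\<And>x y. inner (J x) (J y) = inner x y) \<Longrightarrow> (\<And>s x. T s (J x) = J (T s x)) \<Longrightarrow>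
           B (J x) (J y) = B x y"
    by (fact invariant_form[OF amenable hom cont' m'(3) bounds(2) less_imp_le[OF m'(1)]])
  obtain P :: "'h \<Rightarrow>\<^sub>L 'h" where P: "\<And>x y. inner (P x) y = B x y"
    using bounded_bilinear_form_operator[OF \<open>bounded_bilinear B\<close>] by blast
  have "selfadjoint_op P"
    by (simp add: selfadjoint_op_def P inner_commute[of _ "P _"] B(1))
  obtain A :: "'h \<Rightarrow>\<^sub>L 'h" where A: "selfadjoint_op A" "invertible_op A" "A o\<^sub>L A = P"
    "\<And>x. m' * (norm x)\<^sup>2 \<le> inner (A x) x" "\<And>x. inner (A x) x \<le> M * (norm x)\<^sup>2"
    and comm: "\<And>J :: 'h \<Rightarrow>\<^sub>L 'h. J o\<^sub>L P = P o\<^sub>L J \<Longrightarrow> J o\<^sub>L A = A o\<^sub>L J"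
    by (fact positive_square_root[OF \<open>selfadjoint_op P\<close> m'(1,2) B(3,4)[folded P]])
  have AB: "inner (A x) (A y) = B x y" for x y
    using A(1) P[of x y] by (simp add: selfadjoint_op_def flip: A(3))
  have AT: "norm (A (T s x)) = norm (A x)" for s x
    by (simp add: norm_eq_sqrt_inner AB B(2))
  have Ainv: "A (inverse_op A x) = x" for x
    using arg_cong[OF inverse_op(1)[OF A(2)], of "\<lambda>B. B x"] by simp
  show ?thesis
  proof
    show "isometry_op (A o\<^sub>L T s o\<^sub>L inverse_op A)" for s
      unfolding isometry_op_def
      by (simp add: dist_norm AT Ainv flip: blinfun.diff_right)
    show "m * (norm x)\<^sup>2 \<le> inner (A x) x" for x
    proof (cases "x = 0")
      case False
      have "m * norm x \<le> M * norm x"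
        using bounds by (rule order_trans)
      with False have "m \<le> M" by simp
      then show ?thesis using A(4) by (simp add: m'_def)
    qed simp
    show "J o\<^sub>L A = A o\<^sub>L J" if TJ: "\<And>s. T s o\<^sub>L J = J o\<^sub>L T s"
      and J: "\<And>x y. inner (J x) (J y) = inner x y" "surj J" for J :: "'h \<Rightarrow>\<^sub>L 'h"
    proof (rule comm, rule blinfun_eqI)
      fix x
      have "T s (J x) = J (T s x)" for s x
        using arg_cong[OF TJ, of "\<lambda>B. B x"] by simp
      \<comment> \<open>Both sides equal \<open>B x y\<close>: \<open>J\<close> preserves the invariant form as well as the inner product.\<close>
      then have "inner (P (J x)) (J y) = inner (J (P x)) (J y)" for y
        by (simp add: P BJ J(1))
      then have "inner (P (J x)) z = inner (J (P x)) z" for z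
        using J(2) by (metis surjD)
      then show "(J o\<^sub>L P) x = (P o\<^sub>L J) x"
        by (metis vector_eq_rdot blinfun_apply_blinfun_compose)
    qed
  qed (use A in auto)
qed

lemma op_le_scaleR_id:
  fixes A :: "'h::real_inner \<Rightarrow>\<^sub>L 'h"
  assumes "selfadjoint_op A"
  shows "m *\<^sub>R id_blinfun \<le>\<^sub>o\<^sub>p A \<longleftrightarrow> (\<forall>x. m * (norm x)\<^sup>2 \<le> inner (A x) x)"
    and "A \<le>\<^sub>o\<^sub>p M *\<^sub>R id_blinfun \<longleftrightarrow> (\<forall>x. inner (A x) x \<le> M * (norm x)\<^sup>2)"
  using assms
  by (auto simp: op_le_def selfadjoint_op_def blinfun.scaleR_left power2_norm_eq_inner)

lemma positive_similarity:
  fixes T :: "'s::{semigroup_mult,topological_space} \<Rightarrow> ('h::{real_inner,complete_space} \<Rightarrow>\<^sub>L 'h)"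
  assumes "weakly_right_amenable TYPE('s)"
    and "\<And>s t. T (s * t) = T s o\<^sub>L T t"
    and "continuous_map euclidean strong_operator_topology T"
    and "\<forall>s x. m * norm x \<le> norm (T s x) \<and> norm (T s x) \<le> M * norm x"
    and "0 < m" "0 < M"
  obtains A :: "'h \<Rightarrow>\<^sub>L 'h" where "positive_op A" and "invertible_op A"
    and "\<And>s. isometry_op (A o\<^sub>L T s o\<^sub>L inverse_op A)"
    and "m *\<^sub>R id_blinfun \<le>\<^sub>o\<^sub>p A" and "A \<le>\<^sub>o\<^sub>p M *\<^sub>R id_blinfun"
    and "\<And>J :: 'h \<Rightarrow>\<^sub>L 'h. (\<And>s. T s o\<^sub>L J = J o\<^sub>L T s) \<Longrightarrow>
           (\<And>x y. inner (J x) (J y) = inner x y) \<Longrightarrow> surj J \<Longrightarrow> J o\<^sub>L A = A o\<^sub>L J"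
proof (rule similar_to_isometries[OF assms(1-3) _ _ assms(5,6)])
  fix A :: "'h \<Rightarrow>\<^sub>L 'h"
  assume sa: "selfadjoint_op A" and lower: "\<And>x. m * (norm x)\<^sup>2 \<le> inner (A x) x"
    and rest: "invertible_op A" "\<And>s. isometry_op (A o\<^sub>L T s o\<^sub>L inverse_op A)"
      "\<And>x. inner (A x) x \<le> M * (norm x)\<^sup>2"
      "\<And>J :: 'h \<Rightarrow>\<^sub>L 'h. (\<And>s. T s o\<^sub>L J = J o\<^sub>L T s) \<Longrightarrow>
        (\<And>x y. inner (J x) (J y) = inner x y) \<Longrightarrow> surj J \<Longrightarrow> J o\<^sub>L A = A o\<^sub>L J"
  have "0 \<le> inner (A x) x" for x
    using \<open>0 < m\<close> by (intro order_trans[OF _ lower]) simp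
  then have "positive_op A"
    using sa by (simp add: positive_op_def op_le_def selfadjoint_op_def)
  then show thesis
    using sa lower rest by (intro that) (auto simp: op_le_scaleR_id)
qed (use assms(4) in auto)

text \<open>
  From \<open>\<parallel>A T\<^sub>s x\<parallel> = \<parallel>A x\<parallel>\<close>, each of \<open>\<parallel>T\<^sub>s x\<parallel>\<close> and \<open>\<parallel>x\<parallel>\<close> is at most
  \<open>\<parallel>A\<^sup>-\<^sup>1\<parallel> \<parallel>A\<parallel>\<close> times the other.
\<close>
lemma bounds_of_similar_to_isometries:
  fixes T :: "'s \<Rightarrow> ('h::real_normed_vector \<Rightarrow>\<^sub>L 'h)"
  assumes "invertible_op A" and iso: "\<And>s. isometry_op (A o\<^sub>L T s o\<^sub>L inverse_op A)"
  shows "\<exists>m>0. \<exists>M>0. \<forall>s x. m * norm x \<le> norm (T s x) \<and> norm (T s x) \<le> M * norm x"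
proof -
  have inv: "inverse_op A (A x) = x" for x
    using arg_cong[OF inverse_op(2)[OF assms(1)], of "\<lambda>B. B x"] by simp
  have AT: "norm (A (T s x)) = norm (A x)" for s x
    using iso[of s, unfolded isometry_op_def, rule_format, of "A x" 0]
    by (simp add: inv blinfun.zero_right)
  \<comment> \<open>The summand \<open>1\<close> keeps \<open>K\<close> positive on the zero space.\<close>
  define K where "K = norm (inverse_op A) * norm A + 1"
  have "0 < K" by (simp add: K_def add_nonneg_pos)
  have le: "norm y \<le> K * norm x" if "norm (A y) = norm (A x)" for x y
  proof -
    have "norm y \<le> norm (inverse_op A) * norm (A x)"
      using norm_blinfun[of "inverse_op A" "A y"] by (simp add: inv that)
    also have "\<dots> \<le> norm (inverse_op A) * (norm A * norm x)"
      by (intro mult_left_mono norm_blinfun) simp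
    also have "\<dots> \<le> K * norm x"
      by (simp add: K_def algebra_simps)
    finally show ?thesis .
  qed
  have "1 / K * norm x \<le> norm (T s x)" "norm (T s x) \<le> K * norm x" for s x
    using le[of x "T s x"] le[of "T s x" x] \<open>0 < K\<close> by (simp_all add: AT field_simps)
  then show ?thesis
    using \<open>0 < K\<close> by (intro exI[of _ "1 / K"] exI[of _ K] conjI) auto
qed

section \<open>Complex scalars\<close>
lemma cinner_scaleC_right: "cinner x (a *\<^sub>C y) = cnj a * cinner x y"
  for x y :: "'h::complex_inner"
  by (metis cinner_commute cinner_scaleC_left complex_cnj_mult)

lemma inner_imaginary_unit: "inner (\<i> *\<^sub>C x) (\<i> *\<^sub>C y) = inner x y"
  for x y :: "'h::complex_inner"
  by (simp add: inner_eq_Re_cinner cinner_scaleC_left cinner_scaleC_right)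

lemma bounded_linear_imaginary_unit: "bounded_linear (\<lambda>x :: 'h::complex_inner. \<i> *\<^sub>C x)"
proof (rule bounded_linear_intro[where K = 1])
  show "\<i> *\<^sub>C r *\<^sub>R x = r *\<^sub>R \<i> *\<^sub>C x" for r and x :: 'h
    by (simp add: scaleC_scaleC mult.commute flip: scaleC_of_real)
qed (simp_all add: scaleC_add_right norm_eq_sqrt_inner inner_imaginary_unit)

lemma clinear_opsI:
  fixes A :: "'h::complex_inner \<Rightarrow>\<^sub>L 'h"
  assumes "\<And>x. A (\<i> *\<^sub>C x) = \<i> *\<^sub>C A x"
  shows "A \<in> clinear_ops"
proof -
  have dec: "c *\<^sub>C x = Re c *\<^sub>R x + Im c *\<^sub>R \<i> *\<^sub>C x" for c and x :: 'h
  proof -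
    have "Re c *\<^sub>R x + Im c *\<^sub>R \<i> *\<^sub>C x =
        (complex_of_real (Re c) + complex_of_real (Im c) * \<i>) *\<^sub>C x"
      by (simp only: scaleC_add_left scaleC_of_real scaleC_scaleC[symmetric])
    also have "complex_of_real (Re c) + complex_of_real (Im c) * \<i> = c"
      by (simp add: complex_eq_iff)
    finally show ?thesis by simp
  qed
  have "A (c *\<^sub>C x) = c *\<^sub>C A x" for c x
    by (simp add: dec[of c] blinfun.add_right blinfun.scaleR_right assms)
  then show ?thesis by (simp add: clinear_ops_def)
qed

text \<open>
  The imaginary part of \<open>cinner (A x) y\<close> is the real part of the same expression with \<open>\<i> y\<close> in place
  of \<open>y\<close>.
\<close>
lemma cselfadjoint_opI:
  fixes A :: "'h::complex_inner \<Rightarrow>\<^sub>L 'h"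
  assumes "A \<in> clinear_ops" and "selfadjoint_op A"
  shows "cselfadjoint_op A"
proof -
  have Re: "Re (cinner (A x) y) = Re (cinner x (A y))" for x y
    using assms(2) by (simp add: selfadjoint_op_def inner_eq_Re_cinner)
  have "Im (cinner (A x) y) = Im (cinner x (A y))" for x y
    using Re[of x "\<i> *\<^sub>C y"] assms(1) by (simp add: clinear_ops_def cinner_scaleC_right)
  with Re assms(1) show ?thesis
    by (auto simp: cselfadjoint_op_def intro: complex_eqI)
qed

lemma cop_leI:
  assumes "A \<in> clinear_ops" "B \<in> clinear_ops"
    and "A \<le>\<^sub>o\<^sub>p B"
  shows "A \<le>\<^sub>c\<^sub>o\<^sub>p B"
  using assms by (auto simp: op_le_def cop_le_def cselfadjoint_opI inner_eq_Re_cinner)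

lemma scaleR_id_blinfun_in_clinear_ops: "r *\<^sub>R id_blinfun \<in> clinear_ops"
  by (rule clinear_opsI)
    (simp add: blinfun.scaleR_left linear_scale[OF bounded_linear.linear[OF bounded_linear_imaginary_unit]])

text \<open>
  The real operator \<open>A\<close> obtained from the real theory commutes with multiplication by \<open>\<i>\<close>, which is a
  surjective isometry commuting with the complex-linear operators \<open>T\<^sub>s\<close>.
\<close>
lemma positive_complex_similarity:
  fixes T :: "'s::{semigroup_mult,topological_space} \<Rightarrow> ('h::{complex_inner,complete_space} \<Rightarrow>\<^sub>L 'h)"
  assumes "weakly_right_amenable TYPE('s)" and clin: "\<And>s. T s \<in> clinear_ops"
    and "\<And>s t. T (s * t) = T s o\<^sub>L T t"
    and "continuous_map euclidean strong_operator_topology T"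
    and "\<forall>s x. m * norm x \<le> norm (T s x) \<and> norm (T s x) \<le> M * norm x"
    and "0 < m" "0 < M"
  shows "\<exists>A\<in>clinear_ops. cpositive_op A \<and> invertible_op A \<and>
    (\<forall>s. isometry_op (A o\<^sub>L T s o\<^sub>L inverse_op A)) \<and>
    m *\<^sub>R id_blinfun \<le>\<^sub>c\<^sub>o\<^sub>p A \<and> A \<le>\<^sub>c\<^sub>o\<^sub>p M *\<^sub>R id_blinfun"
proof -
  obtain A :: "'h \<Rightarrow>\<^sub>L 'h" where A: "positive_op A" "invertible_op A"
    "\<And>s. isometry_op (A o\<^sub>L T s o\<^sub>L inverse_op A)"
    "m *\<^sub>R id_blinfun \<le>\<^sub>o\<^sub>p A" "A \<le>\<^sub>o\<^sub>p M *\<^sub>R id_blinfun"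
    and comm: "\<And>J :: 'h \<Rightarrow>\<^sub>L 'h. (\<And>s. T s o\<^sub>L J = J o\<^sub>L T s) \<Longrightarrow>
      (\<And>x y. inner (J x) (J y) = inner x y) \<Longrightarrow> surj J \<Longrightarrow> J o\<^sub>L A = A o\<^sub>L J"
    by (fact positive_similarity[OF assms(1,3-7)])
  define J :: "'h \<Rightarrow>\<^sub>L 'h" where "J = Blinfun (\<lambda>x. \<i> *\<^sub>C x)"
  have J: "J x = \<i> *\<^sub>C x" for x
    by (simp add: J_def bounded_linear_Blinfun_apply bounded_linear_imaginary_unit)
  have "J (- \<i> *\<^sub>C x) = x" for x
    using scaleC_of_real[of 1 x] by (simp add: J scaleC_scaleC)
  then have "surj J" by (rule surjI)
  moreover have "T s o\<^sub>L J = J o\<^sub>L T s" for s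
    using clin by (auto simp: J clinear_ops_def intro: blinfun_eqI)
  ultimately have "J o\<^sub>L A = A o\<^sub>L J"
    by (intro comm) (simp_all add: J inner_imaginary_unit)
  then have "A (\<i> *\<^sub>C x) = \<i> *\<^sub>C A x" for x
    by (metis J blinfun_apply_blinfun_compose)
  then have "A \<in> clinear_ops" by (rule clinear_opsI)
  moreover have "(0 :: 'h \<Rightarrow>\<^sub>L 'h) \<in> clinear_ops"
    using scaleR_id_blinfun_in_clinear_ops[of 0] by simp
  ultimately show ?thesis
    using A by (intro bexI[of _ A] conjI allI)
      (auto simp: positive_op_def cpositive_op_def intro: cop_leI scaleR_id_blinfun_in_clinear_ops)
qed

theorem corollary4p17:
  assumes "weakly_right_amenable TYPE('s::{semigroup_mult,topological_space})"
  shows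
    "(\<forall>T :: 's \<Rightarrow> ('r::{real_inner,complete_space} \<Rightarrow>\<^sub>L 'r).
        (\<forall>s t. T (s * t) = T s o\<^sub>L T t) \<and>
        continuous_map euclidean strong_operator_topology T \<longrightarrow>
        ((\<exists>A. positive_op A \<and> invertible_op A \<and>
               (\<forall>s. isometry_op (A o\<^sub>L T s o\<^sub>L inverse_op A))) \<longleftrightarrow>
         (\<exists>m>0. \<exists>M>0. \<forall>s x. m * norm x \<le> norm (T s x) \<and> norm (T s x) \<le> M * norm x)) \<and>
        (\<forall>m>0. \<forall>M>0.
           (\<forall>s x. m * norm x \<le> norm (T s x) \<and> norm (T s x) \<le> M * norm x) \<longrightarrow>
           (\<exists>A. positive_op A \<and> invertible_op A \<and>
                (\<forall>s. isometry_op (A o\<^sub>L T s o\<^sub>L inverse_op A)) \<and>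
                m *\<^sub>R id_blinfun \<le>\<^sub>o\<^sub>p A \<and> A \<le>\<^sub>o\<^sub>p M *\<^sub>R id_blinfun)))
     \<and>
     (\<forall>T :: 's \<Rightarrow> ('c::{complex_inner,complete_space} \<Rightarrow>\<^sub>L 'c).
        (\<forall>s. T s \<in> clinear_ops) \<and>
        (\<forall>s t. T (s * t) = T s o\<^sub>L T t) \<and>
        continuous_map euclidean strong_operator_topology T \<longrightarrow>
        ((\<exists>A\<in>clinear_ops. cpositive_op A \<and> invertible_op A \<and>
               (\<forall>s. isometry_op (A o\<^sub>L T s o\<^sub>L inverse_op A))) \<longleftrightarrow>
         (\<exists>m>0. \<exists>M>0. \<forall>s x. m * norm x \<le> norm (T s x) \<and> norm (T s x) \<le> M * norm x)) \<and>
        (\<forall>m>0. \<forall>M>0.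
           (\<forall>s x. m * norm x \<le> norm (T s x) \<and> norm (T s x) \<le> M * norm x) \<longrightarrow>
           (\<exists>A\<in>clinear_ops. cpositive_op A \<and> invertible_op A \<and>
                (\<forall>s. isometry_op (A o\<^sub>L T s o\<^sub>L inverse_op A)) \<and>
                m *\<^sub>R id_blinfun \<le>\<^sub>c\<^sub>o\<^sub>p A \<and> A \<le>\<^sub>c\<^sub>o\<^sub>p M *\<^sub>R id_blinfun)))"
proof (intro conjI allI impI; (elim conjE)?)
  fix T :: "'s \<Rightarrow> ('r \<Rightarrow>\<^sub>L 'r)"
  assume T: "\<forall>s t. T (s * t) = T s o\<^sub>L T t" "continuous_map euclidean strong_operator_topology T"
  show similar: "\<exists>A. positive_op A \<and> invertible_op A \<and>
      (\<forall>s. isometry_op (A o\<^sub>L T s o\<^sub>L inverse_op A)) \<and>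
      m *\<^sub>R id_blinfun \<le>\<^sub>o\<^sub>p A \<and> A \<le>\<^sub>o\<^sub>p M *\<^sub>R id_blinfun"
    if "0 < m" "0 < M" "\<forall>s x. m * norm x \<le> norm (T s x) \<and> norm (T s x) \<le> M * norm x" for m M
    by (rule positive_similarity[OF assms T(1)[rule_format] T(2) that(3,1,2)]) blast
  show "(\<exists>A. positive_op A \<and> invertible_op A \<and>
      (\<forall>s. isometry_op (A o\<^sub>L T s o\<^sub>L inverse_op A))) \<longleftrightarrow>
    (\<exists>m>0. \<exists>M>0. \<forall>s x. m * norm x \<le> norm (T s x) \<and> norm (T s x) \<le> M * norm x)"
    using bounds_of_similar_to_isometries[of _ T] similar by meson
next
  fix T :: "'s \<Rightarrow> ('c \<Rightarrow>\<^sub>L 'c)"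
  assume T: "\<forall>s. T s \<in> clinear_ops" "\<forall>s t. T (s * t) = T s o\<^sub>L T t"
    "continuous_map euclidean strong_operator_topology T"
  show similar: "\<exists>A\<in>clinear_ops. cpositive_op A \<and> invertible_op A \<and>
      (\<forall>s. isometry_op (A o\<^sub>L T s o\<^sub>L inverse_op A)) \<and>
      m *\<^sub>R id_blinfun \<le>\<^sub>c\<^sub>o\<^sub>p A \<and> A \<le>\<^sub>c\<^sub>o\<^sub>p M *\<^sub>R id_blinfun"
    if "0 < m" "0 < M" "\<forall>s x. m * norm x \<le> norm (T s x) \<and> norm (T s x) \<le> M * norm x" for m M
    by (rule positive_complex_similarity[OF assms T(1)[rule_format] T(2)[rule_format] T(3) that(3,1,2)])
  show "(\<exists>A\<in>clinear_ops. cpositive_op A \<and> invertible_op A \<and>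
      (\<forall>s. isometry_op (A o\<^sub>L T s o\<^sub>L inverse_op A))) \<longleftrightarrow>
    (\<exists>m>0. \<exists>M>0. \<forall>s x. m * norm x \<le> norm (T s x) \<and> norm (T s x) \<le> M * norm x)"
    using bounds_of_similar_to_isometries[of _ T] similar by meson
qed

end
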